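(* Let $\mathcal{H}$ be a complex Hilbert space and let $V$ be a bounded linear operator on $\mathcal{H}$ that is a partial isometry. The following conditions are equivalent: (i) $V$ is quasinormal; (ii) $V$ is absolute-$(p,r)$-paranormal for some real numbers $p,r>0$; (iii) ${V^*}^2V^2=V^*V$; (iv) ${V^*}^2V^2\geq V^*V$.
   Context: For a bounded linear operator $T$ on a complex Hilbert space $\mathcal{H}$, $|T|=(T^*T)^{1/2}$ and $|T^*|=(TT^* )^{1/2}$; real positive powers of positive operators are defined by functional calculus. For $p,r>0$, $T$ is called absolute-$(p,r)$-paranormal if $\| |T|^p |T^*|^r x \|^r \geq \| |T^*|^r x \|^{p+r}$ for every unit vector $x\in\mathcal{H}$ (equivalently, $\| |T|^p |T^*|^r x \|^r\|x\|^p \geq \| |T^*|^r x \|^{p+r}$ for all $x\in\mathcal{H}$). $T$ is a partial isometry if $T^*T$ is an orthogonal projection, and quasinormal if $T$ commutes with $T^*T$, i.e. $TT^*T=T^*T^2$. For self-adjoint operators, $A\geq B$ means $\langle (A-B)x,x\rangle\geq 0$ for all $x\in\mathcal{H}$. *)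

theory Defs
  imports "HOL-Analysis.Analysis" "HOL-Computational_Algebra.Polynomial"
begin

section \<open>Complex Hilbert spaces\<close>

text \<open>
  The inner product is linear in the first argument.  Positivity and definiteness are
  contained in the last axiom, which says that the norm of the underlying real normed space
  is the one induced by the inner product.
\<close>

class complex_inner = real_normed_vector +
  fixes scaleC :: "complex \<Rightarrow> 'a \<Rightarrow> 'a"  (infixr "*\<^sub>C" 75)
    and cinner :: "'a \<Rightarrow> 'a \<Rightarrow> complex"
  assumes scaleC_add_right: "c *\<^sub>C (x + y) = c *\<^sub>C x + c *\<^sub>C y"
    and scaleC_add_left: "(c + d) *\<^sub>C x = c *\<^sub>C x + d *\<^sub>C x"
    and scaleC_scaleC: "c *\<^sub>C (d *\<^sub>C x) = (c * d) *\<^sub>C x"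
    and scaleC_of_real: "complex_of_real a *\<^sub>C x = a *\<^sub>R x"
    and cinner_commute: "cinner x y = cnj (cinner y x)"
    and cinner_add_left: "cinner (x + y) z = cinner x z + cinner y z"
    and cinner_scaleC_left: "cinner (c *\<^sub>C x) y = c * cinner x y"
    and cinner_self: "cinner x x = complex_of_real ((norm x)\<^sup>2)"

class complex_hilbert = complex_inner + complete_space
begin

subclass banach ..

end

instantiation complex :: complex_hilbert
begin

definition scaleC_complex :: "complex \<Rightarrow> complex \<Rightarrow> complex"
  where "scaleC_complex c x = c * x"

definition cinner_complex :: "complex \<Rightarrow> complex \<Rightarrow> complex"
  where "cinner_complex x y = x * cnj y"

instance
proof
  fix x y z c d :: complex and a :: real
  show "cinner x x = complex_of_real ((norm x)\<^sup>2)"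
    by (simp only: cinner_complex_def complex_norm_square)
qed (simp_all add: scaleC_complex_def cinner_complex_def algebra_simps scaleR_conv_of_real)

end

section \<open>Bounded operators\<close>

text \<open>
  The type \<open>'a \<Rightarrow>\<^sub>L 'a\<close> consists of the bounded real-linear maps, with the operator norm.  A
  bounded operator on the complex space is an element satisfying \<open>complex_linear\<close>;
  the notions below are meant for such elements.
\<close>

definition complex_linear :: "('a::complex_inner \<Rightarrow>\<^sub>L 'a) \<Rightarrow> bool"
  where "complex_linear T \<longleftrightarrow> (\<forall>c x. T (c *\<^sub>C x) = c *\<^sub>C T x)"

definition cadjoint :: "('a::complex_hilbert \<Rightarrow>\<^sub>L 'a) \<Rightarrow> ('a \<Rightarrow>\<^sub>L 'a)"
  where "cadjoint T = (THE S :: 'a \<Rightarrow>\<^sub>L 'a. \<forall>x y. cinner (T x) y = cinner x (S y))"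

primrec op_power :: "('a::real_normed_vector \<Rightarrow>\<^sub>L 'a) \<Rightarrow> nat \<Rightarrow> ('a \<Rightarrow>\<^sub>L 'a)"
  where
    "op_power T 0 = id_blinfun"
  | "op_power T (Suc n) = T o\<^sub>L op_power T n"

definition op_ge :: "('a::complex_hilbert \<Rightarrow>\<^sub>L 'a) \<Rightarrow> ('a \<Rightarrow>\<^sub>L 'a) \<Rightarrow> bool"
  where "op_ge A B \<longleftrightarrow> (\<forall>x. cinner ((A - B) x) x \<in> \<real>\<^sub>\<ge>\<^sub>0)"

definition orthogonal_projection :: "('a::complex_hilbert \<Rightarrow>\<^sub>L 'a) \<Rightarrow> bool"
  where "orthogonal_projection P \<longleftrightarrow> P o\<^sub>L P = P \<and> cadjoint P = P"

definition partial_isometry :: "('a::complex_hilbert \<Rightarrow>\<^sub>L 'a) \<Rightarrow> bool"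
  where "partial_isometry T \<longleftrightarrow> orthogonal_projection (cadjoint T o\<^sub>L T)"

definition quasinormal :: "('a::complex_hilbert \<Rightarrow>\<^sub>L 'a) \<Rightarrow> bool"
  where "quasinormal T \<longleftrightarrow> T o\<^sub>L (cadjoint T o\<^sub>L T) = (cadjoint T o\<^sub>L T) o\<^sub>L T"

section \<open>Functional calculus and real powers\<close>

definition op_spectrum :: "('a::complex_hilbert \<Rightarrow>\<^sub>L 'a) \<Rightarrow> complex set"
  where "op_spectrum A =
    {z. \<not> (\<exists>S :: 'a \<Rightarrow>\<^sub>L 'a. \<forall>x. S (A x - z *\<^sub>C x) = x \<and> A (S x) - z *\<^sub>C S x = x)}"

definition op_poly :: "real poly \<Rightarrow> ('a::real_normed_vector \<Rightarrow>\<^sub>L 'a) \<Rightarrow> ('a \<Rightarrow>\<^sub>L 'a)"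
  where "op_poly q A = (\<Sum>i\<le>degree q. coeff q i *\<^sub>R op_power A i)"

text \<open>
  Continuous functional calculus of a self-adjoint operator \<open>A\<close> for a real function \<open>f\<close>
  continuous on the (real) spectrum: \<open>f(A)\<close> is the operator-norm limit of \<open>q\<^sub>n(A)\<close> for real
  polynomials \<open>q\<^sub>n\<close> converging to \<open>f\<close> uniformly on the spectrum.
\<close>

definition fun_calculus :: "(real \<Rightarrow> real) \<Rightarrow> ('a::complex_hilbert \<Rightarrow>\<^sub>L 'a) \<Rightarrow> ('a \<Rightarrow>\<^sub>L 'a)"
  where "fun_calculus f A =
    (THE B :: 'a \<Rightarrow>\<^sub>L 'a. \<forall>q :: nat \<Rightarrow> real poly.
      uniform_limit {t. complex_of_real t \<in> op_spectrum A} (\<lambda>n. poly (q n)) f sequentially \<longrightarrow>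
      (\<lambda>n. op_poly (q n) A) \<longlonglongrightarrow> B)"

text \<open>Intended for positive \<open>A\<close> and \<open>p > 0\<close>; note \<open>0 powr p = 0\<close>.\<close>

definition op_powr :: "('a::complex_hilbert \<Rightarrow>\<^sub>L 'a) \<Rightarrow> real \<Rightarrow> ('a \<Rightarrow>\<^sub>L 'a)"
  where "op_powr A p = fun_calculus (\<lambda>t. t powr p) A"

definition op_abs :: "('a::complex_hilbert \<Rightarrow>\<^sub>L 'a) \<Rightarrow> ('a \<Rightarrow>\<^sub>L 'a)"
  where "op_abs T = op_powr (cadjoint T o\<^sub>L T) (1 / 2)"

text \<open>
  In the next definition \<open>op_abs (cadjoint T)\<close> is \<open>(T T\<^sup>*)\<^sup>1\<^sup>/\<^sup>2\<close>, because
  \<open>T\<^sup>*\<^sup>* = T\<close>.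
\<close>

definition absolute_paranormal :: "real \<Rightarrow> real \<Rightarrow> ('a::complex_hilbert \<Rightarrow>\<^sub>L 'a) \<Rightarrow> bool"
  where "absolute_paranormal p r T \<longleftrightarrow>
    (\<forall>x. norm x = 1 \<longrightarrow>
      norm (op_powr (op_abs T) p (op_powr (op_abs (cadjoint T)) r x)) powr r
        \<ge> norm (op_powr (op_abs (cadjoint T)) r x) powr (p + r))"

end

theory Submission
  imports Defs
begin

text \<open>
  Let \<open>P = V\<^sup>*V\<close> and \<open>Q = VV\<^sup>*\<close>.  For a partial isometry \<open>P\<close> is an orthogonal projection and
  \<open>VP = V\<close>, so \<open>Q\<close> is an orthogonal projection as well.  Quasinormality \<open>VP = PV\<close> therefore
  just says \<open>PV = V\<close>: the range of \<open>V\<close> lies in the range of \<open>P\<close>.  Each of the other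
  conditions is a way of saying that \<open>P\<close> does not shorten the vectors in the range of \<open>V\<close>,
  and a vector that an orthogonal projection does not shorten is fixed by it
  (\<open>projection_fixes_if_norm_ge\<close>).

  For condition (iv) this is the identity
  \<open>\<langle>(V\<^sup>*\<^sup>2V\<^sup>2 - V\<^sup>*V)x, x\<rangle> = \<parallel>PVx\<parallel>\<^sup>2 - \<parallel>Vx\<parallel>\<^sup>2\<close>.  For paranormality, every positive
  power of a projection is the projection itself (\<open>op_powr_idempotent\<close>), because its spectrum
  is contained in \<open>{0, 1}\<close>.  Hence \<open>|V|\<^sup>p = P\<close> and \<open>|V\<^sup>*|\<^sup>r = Q\<close>, and the condition becomes
  \<open>\<parallel>PQx\<parallel>\<^sup>r \<ge> \<parallel>Qx\<parallel>\<^sup>p\<^sup>+\<^sup>r\<close> for unit vectors \<open>x\<close>; at unit vectors in the range of \<open>Q\<close>, which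
  is the range of \<open>V\<close>, it reads \<open>\<parallel>Px\<parallel> \<ge> 1 = \<parallel>x\<parallel>\<close>.

  The adjoint is a definite description, so its defining property rests on the Riesz
  representation theorem (\<open>riesz_representation_real\<close>), proved by minimising the energy
  \<open>\<parallel>x\<parallel>\<^sup>2 / 2 - f x\<close>.
\<close>

section \<open>The real part of the inner product\<close>

lemma Re_cinner_commute: "Re (cinner x y) = Re (cinner y (x::'a::complex_inner))"
  by (subst cinner_commute) simp

lemma norm_sq_eq_Re_cinner: "(norm (x::'a::complex_inner))\<^sup>2 = Re (cinner x x)"
  by (simp add: cinner_self)

lemma cinner_add_right: "cinner x (y + z) = cinner x y + cinner x (z::'a::complex_inner)"
  by (metis cinner_add_left cinner_commute complex_cnj_add)

lemma cinner_scaleR_left: "cinner (a *\<^sub>R x) y = of_real a * cinner x (y::'a::complex_inner)"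
  by (metis cinner_scaleC_left scaleC_of_real)

lemma cinner_scaleR_right: "cinner x (a *\<^sub>R y) = of_real a * cinner x (y::'a::complex_inner)"
  by (metis cinner_commute cinner_scaleR_left complex_cnj_complex_of_real complex_cnj_mult)

lemma cinner_zero_left: "cinner 0 (x::'a::complex_inner) = 0"
  using cinner_scaleR_left[of 0 0 x] by simp

lemma norm_add_sq:
  "(norm (x + y))\<^sup>2 = (norm x)\<^sup>2 + 2 * Re (cinner x y) + (norm (y::'a::complex_inner))\<^sup>2"
  by (simp add: norm_sq_eq_Re_cinner cinner_add_left cinner_add_right Re_cinner_commute[of y x])

text \<open>
  Since the norm is known to satisfy the triangle inequality, the Cauchy--Schwarz inequality
  follows by expanding \<open>\<parallel>x + y\<parallel>\<^sup>2 \<le> (\<parallel>x\<parallel> + \<parallel>y\<parallel>)\<^sup>2\<close>.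
\<close>

lemma Re_cinner_le: "Re (cinner x y) \<le> norm x * norm (y::'a::complex_inner)"
proof -
  have "(norm (x + y))\<^sup>2 \<le> (norm x + norm y)\<^sup>2"
    by (intro power_mono norm_triangle_ineq norm_ge_zero)
  then show ?thesis
    by (simp add: norm_add_sq power2_sum)
qed

lemma abs_Re_cinner_le: "\<bar>Re (cinner x y)\<bar> \<le> norm x * norm (y::'a::complex_inner)"
  using Re_cinner_le[of x y] Re_cinner_le[of "- x" y] cinner_scaleR_left[of "-1" x y]
  by simp

lemma bounded_bilinear_Re_cinner:
  "bounded_bilinear (\<lambda>x y::'a::complex_inner. Re (cinner x y))"
  by standard
    (auto simp: cinner_add_left cinner_add_right cinner_scaleR_left cinner_scaleR_right
      intro!: exI[of _ 1] abs_Re_cinner_le)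

lemmas Re_cinner_zero_left = bounded_bilinear.zero_left[OF bounded_bilinear_Re_cinner]
  and Re_cinner_diff_left = bounded_bilinear.diff_left[OF bounded_bilinear_Re_cinner]
  and Re_cinner_diff_right = bounded_bilinear.diff_right[OF bounded_bilinear_Re_cinner]

lemma cinner_eqI_right:
  fixes y z :: "'a::complex_inner"
  assumes "\<And>x. Re (cinner x y) = Re (cinner x z)"
  shows "y = z"
proof -
  have "(norm (y - z))\<^sup>2 = 0"
    unfolding norm_sq_eq_Re_cinner Re_cinner_diff_right using assms by simp
  then show ?thesis by simp
qed

section \<open>The Riesz representation theorem and the adjoint\<close>

text \<open>
  The representing vector is the minimiser of the strictly convex energy
  \<open>J x = \<parallel>x\<parallel>\<^sup>2 / 2 - f x\<close>.  By the parallelogram identity a minimising sequence is Cauchy, and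
  the first-order condition at the minimiser is \<open>f h = Re \<langle>h, z\<rangle>\<close>.
\<close>

lemma riesz_representation_real:
  fixes f :: "'a::complex_hilbert \<Rightarrow> real"
  assumes f: "bounded_linear f"
  shows "\<exists>z. \<forall>h. f h = Re (cinner h z)"
proof -
  interpret f: bounded_linear f by (rule f)
  define J where "J x = (norm x)\<^sup>2 / 2 - f x" for x
  define m where "m = Inf (range J)"
  obtain K where K: "\<And>x. norm (f x) \<le> norm x * K"
    using f.bounded by blast
  have "J x \<ge> - K\<^sup>2 / 2" for x
  proof -
    have "f x \<le> norm x * K" using K[of x] by simp
    moreover have "0 \<le> (norm x - K)\<^sup>2" by simp
    ultimately show ?thesis by (simp add: J_def power2_diff)
  qed
  then have bdd: "bdd_below (range J)" by (intro bdd_belowI2[of UNIV "- K\<^sup>2 / 2" J]) simp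
  then have m_le: "m \<le> J x" for x
    by (simp add: m_def cInf_lower)
  have "\<exists>x. J x < m + inverse (Suc n)" for n
    using cInf_lessD[of "range J" "m + inverse (Suc n)"] by (auto simp: m_def)
  then obtain X where X: "\<And>n. J (X n) < m + inverse (Suc n)" by metis
  have par: "(norm (x - y))\<^sup>2 / 4 = J x + J y - 2 * J ((1/2) *\<^sub>R (x + y))" for x y
  proof -
    have "(norm ((1/2) *\<^sub>R (x + y)))\<^sup>2 = (norm (x + y))\<^sup>2 / 4"
      by (simp add: power_divide del: scaleR_add_right)
    moreover have "f ((1/2) *\<^sub>R (x + y)) = (f x + f y) / 2"
      by (simp add: f.scaleR f.add del: scaleR_add_right)
    moreover have "(norm (x - y))\<^sup>2 = (norm x)\<^sup>2 - 2 * Re (cinner x y) + (norm y)\<^sup>2"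
      using norm_add_sq[of x "- y"] cinner_scaleR_right[of x "-1" y] by simp
    ultimately show ?thesis
      using norm_add_sq[of x y] unfolding J_def by argo
  qed
  have close: "(norm (X a - X b))\<^sup>2 < 4 * (inverse (Suc a) + inverse (Suc b))" for a b
    using par[of "X a" "X b"] X[of a] X[of b] m_le[of "(1/2) *\<^sub>R (X a + X b)"] by argo
  have "Cauchy X"
  proof (rule CauchyI)
    fix e :: real assume e: "0 < e"
    obtain N where N: "inverse (real (Suc N)) < e\<^sup>2 / 8"
      using reals_Archimedean[of "e\<^sup>2 / 8"] e by auto
    have "norm (X a - X b) < e" if "a \<ge> N" "b \<ge> N" for a b
    proof -
      have "inverse (real (Suc a)) \<le> inverse (Suc N)" "inverse (real (Suc b)) \<le> inverse (Suc N)"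
        using that by (auto intro!: le_imp_inverse_le)
      with close[of a b] N have "(norm (X a - X b))\<^sup>2 < e\<^sup>2" by argo
      with e show ?thesis by (auto intro: power_less_imp_less_base)
    qed
    then show "\<exists>M. \<forall>a\<ge>M. \<forall>b\<ge>M. norm (X a - X b) < e" by blast
  qed
  then obtain z where z: "X \<longlonglongrightarrow> z" by (auto simp: Cauchy_convergent_iff convergent_def)
  have "(\<lambda>n. J (X n)) \<longlonglongrightarrow> J z"
    unfolding J_def by (intro tendsto_intros z f.tendsto) simp
  moreover have "(\<lambda>n. m + inverse (real (Suc n))) \<longlonglongrightarrow> m + 0"
    by (intro tendsto_intros LIMSEQ_inverse_real_of_nat)
  ultimately have "J z \<le> m + 0"
    using X by (intro LIMSEQ_le) (auto intro: less_imp_le)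
  then have J_min: "J z \<le> J x" for x using m_le[of x] by simp
  have "f h = Re (cinner h z)" for h
  proof (cases "h = 0")
    case True
    then show ?thesis by (simp add: f.zero Re_cinner_zero_left)
  next
    case False
    define c where "c = Re (cinner h z) - f h"
    \<comment> \<open>The step \<open>t\<close> minimises the quadratic \<open>s \<mapsto> J (z + s h) - J z = s c + s\<^sup>2\<parallel>h\<parallel>\<^sup>2 / 2\<close>.\<close>
    define t where "t = - c / (norm h)\<^sup>2"
    have "J (z + t *\<^sub>R h) - J z = t * c + t\<^sup>2 * (norm h)\<^sup>2 / 2"
      using norm_add_sq[of z "t *\<^sub>R h"]
      by (simp add: J_def c_def f.add f.scaleR cinner_scaleR_right Re_cinner_commute[of z h]
          power_mult_distrib algebra_simps)
    also have "\<dots> = - (c\<^sup>2 / (norm h)\<^sup>2) / 2"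
      using False by (simp add: t_def field_simps power2_eq_square)
    finally have "c\<^sup>2 / (norm h)\<^sup>2 \<le> 0" using J_min[of "z + t *\<^sub>R h"] by argo
    with False have "c = 0"
      by (simp add: divide_le_0_iff)
    then show ?thesis by (simp add: c_def)
  qed
  then show ?thesis by blast
qed

text \<open>
  Complex linearity enters through \<open>Im w = - Re (\<i> w)\<close>, which recovers the
  full inner product from its real part.
\<close>

lemma adjoint_exists:
  fixes T :: "'a::complex_hilbert \<Rightarrow>\<^sub>L 'a"
  assumes T: "complex_linear T"
  shows "\<exists>S :: 'a \<Rightarrow>\<^sub>L 'a. \<forall>x y. cinner (T x) y = cinner x (S y)"
proof -
  interpret B: bounded_bilinear "\<lambda>x y::'a. Re (cinner x y)"
    by (rule bounded_bilinear_Re_cinner)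
  have "\<exists>z. \<forall>x. Re (cinner (T x) y) = Re (cinner x z)" for y
    by (rule riesz_representation_real)
      (intro bounded_linear_compose[OF B.bounded_linear_left] blinfun.bounded_linear_right)
  then obtain S where S: "\<And>x y. Re (cinner (T x) y) = Re (cinner x (S y))" by metis
  have "bounded_linear S"
  proof (rule bounded_linear_intro[where K = "norm T"])
    show "S (x + y) = S x + S y" for x y
      by (rule cinner_eqI_right) (simp add: B.add_right S[symmetric])
    show "S (a *\<^sub>R x) = a *\<^sub>R S x" for a x
      by (rule cinner_eqI_right) (simp add: B.scaleR_right S[symmetric])
    show "norm (S y) \<le> norm y * norm T" for y
    proof (cases "S y = 0")
      case False
      have "norm (S y) * norm (S y) = Re (cinner (T (S y)) y)"
        by (simp add: S norm_sq_eq_Re_cinner[symmetric] power2_eq_square)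
      also have "\<dots> \<le> norm (T (S y)) * norm y" by (rule Re_cinner_le)
      also have "\<dots> \<le> (norm T * norm (S y)) * norm y"
        by (intro mult_right_mono norm_blinfun) simp
      finally have "norm (S y) * norm (S y) \<le> norm (S y) * (norm y * norm T)"
        by (simp add: ac_simps)
      with False show ?thesis by simp
    qed simp
  qed
  moreover have "cinner (T x) y = cinner x (S y)" for x y
  proof (rule complex_eqI)
    have "T (\<i> *\<^sub>C x) = \<i> *\<^sub>C T x" using T by (simp add: complex_linear_def)
    then show "Im (cinner (T x) y) = Im (cinner x (S y))"
      using S[of "\<i> *\<^sub>C x" y] by (simp add: cinner_scaleC_left)
  qed (rule S)
  ultimately show ?thesis
    by (intro exI[of _ "Blinfun S"]) (simp add: bounded_linear_Blinfun_apply)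
qed

lemma cadjoint_eqI:
  fixes T S :: "'a::complex_hilbert \<Rightarrow>\<^sub>L 'a"
  assumes S: "\<And>x y. cinner (T x) y = cinner x (S y)"
  shows "cadjoint T = S"
  unfolding cadjoint_def
proof (rule the_equality)
  fix R :: "'a \<Rightarrow>\<^sub>L 'a"
  assume "\<forall>x y. cinner (T x) y = cinner x (R y)"
  with S show "R = S"
    by (intro blinfun_eqI cinner_eqI_right) metis
qed (use S in blast)

lemma cinner_cadjoint:
  assumes "complex_linear T"
  shows "cinner (T x) y = cinner x (cadjoint T y)"
  using adjoint_exists[OF assms] cadjoint_eqI by metis

lemma cadjoint_cadjoint:
  assumes "complex_linear T"
  shows "cadjoint (cadjoint T) = T"
  by (rule cadjoint_eqI) (metis assms cinner_cadjoint cinner_commute)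

section \<open>Powers of a projection\<close>

lemma op_power_idempotent:
  assumes "P o\<^sub>L P = P" "n > 0"
  shows "op_power P n = P"
  using assms(2)
proof (induction n rule: nat_induct_non_zero)
  case 1
  then show ?case by (auto intro: blinfun_eqI)
qed (simp add: assms(1))

text \<open>
  This is the spectral decomposition of \<open>P\<close>: the complementary idempotents \<open>id_blinfun - P\<close> and
  \<open>P\<close> project onto its eigenspaces for \<open>0\<close> and \<open>1\<close>.
\<close>

lemma op_poly_idempotent:
  assumes "P o\<^sub>L P = P"
  shows "op_poly q P = poly q 0 *\<^sub>R (id_blinfun - P) + poly q 1 *\<^sub>R P"
proof -
  have "coeff q i *\<^sub>R op_power P i =
      (if i = 0 then coeff q 0 *\<^sub>R (id_blinfun - P) else 0) + coeff q i *\<^sub>R P" for i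
    using op_power_idempotent[OF assms, of i] by (auto simp: algebra_simps)
  then have "op_poly q P =
      coeff q 0 *\<^sub>R (id_blinfun - P) + (\<Sum>i\<le>degree q. coeff q i) *\<^sub>R P"
    by (simp add: op_poly_def sum.distrib scaleR_sum_left)
  then show ?thesis by (simp add: poly_0_coeff_0 poly_altdef)
qed

lemma op_spectrum_idempotent_subset:
  fixes P :: "'a::complex_hilbert \<Rightarrow>\<^sub>L 'a"
  assumes P: "P o\<^sub>L P = P" and t: "complex_of_real t \<in> op_spectrum P"
  shows "t = 0 \<or> t = 1"
proof (rule ccontr)
  assume "\<not> (t = 0 \<or> t = 1)"
  then have t': "t \<noteq> 0" "1 - t \<noteq> 0" by auto
  have PP: "P (P x) = P x" for x
    using P by (metis blinfun_apply_blinfun_compose)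
  \<comment> \<open>The resolvent acts by \<open>1 / (1 - t)\<close> on the range of \<open>P\<close> and by \<open>1 / (0 - t)\<close> on its kernel.\<close>
  define S where "S = (1 / (1 - t)) *\<^sub>R P - (1 / t) *\<^sub>R (id_blinfun - P)"
  have S: "S x = (1 / (1 - t)) *\<^sub>R P x - (1 / t) *\<^sub>R (x - P x)" for x
    by (simp add: S_def blinfun.diff_left blinfun.scaleR_left)
  have split: "(1 / (1 - t) - t * (1 / (1 - t))) *\<^sub>R P x = P x" for x
  proof -
    have "1 / (1 - t) - t * (1 / (1 - t)) = 1" using t' by (simp add: field_simps)
    then show ?thesis by simp
  qed
  have "S (P x - t *\<^sub>R x) = x" for x
  proof -
    have "S (P x - t *\<^sub>R x) =
        (1 / (1 - t) - t * (1 / (1 - t))) *\<^sub>R P x + (t * (1 / t)) *\<^sub>R (x - P x)"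
      by (simp add: S blinfun.diff_right blinfun.scaleR_right PP algebra_simps)
    also have "\<dots> = x" using t' by (simp only: split) simp
    finally show ?thesis .
  qed
  moreover have "P (S x) - t *\<^sub>R S x = x" for x
  proof -
    have "P (S x) - t *\<^sub>R S x =
        (1 / (1 - t) - t * (1 / (1 - t))) *\<^sub>R P x + (t * (1 / t)) *\<^sub>R (x - P x)"
      by (simp add: S blinfun.diff_right blinfun.scaleR_right blinfun.add_right PP algebra_simps)
    also have "\<dots> = x" using t' by (simp only: split) simp
    finally show ?thesis .
  qed
  ultimately have "complex_of_real t \<notin> op_spectrum P"
    unfolding op_spectrum_def by (auto simp: scaleC_of_real)
  with t show False by simp
qed

lemma zero_in_op_spectrum_idempotent:
  fixes P :: "'a::complex_hilbert \<Rightarrow>\<^sub>L 'a"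
  assumes P: "P o\<^sub>L P = P" and "0 \<notin> op_spectrum P"
  shows "P = id_blinfun"
proof -
  have z: "(0::complex) *\<^sub>C x = 0" for x :: 'a
    using scaleC_of_real[of 0 x] by simp
  obtain S :: "'a \<Rightarrow>\<^sub>L 'a" where S: "\<And>x. S (P x) = x"
    using assms(2) by (auto simp: op_spectrum_def z)
  have "P (P x) = P x" for x
    using P by (metis blinfun_apply_blinfun_compose)
  then have "P x = x" for x using S by metis
  then show ?thesis by (intro blinfun_eqI) simp
qed

lemma one_in_op_spectrum_idempotent:
  fixes P :: "'a::complex_hilbert \<Rightarrow>\<^sub>L 'a"
  assumes P: "P o\<^sub>L P = P" and "1 \<notin> op_spectrum P"
  shows "P = 0"
proof -
  have z: "(1::complex) *\<^sub>C x = x" for x :: 'a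
    using scaleC_of_real[of 1 x] by simp
  obtain S :: "'a \<Rightarrow>\<^sub>L 'a" where S: "\<And>x. S (P x - x) = x"
    using assms(2) by (auto simp: op_spectrum_def z)
  have "P (P x) - P x = 0" for x
    using P by (metis blinfun_apply_blinfun_compose diff_self)
  then have "P x = 0" for x using S[of "P x"] by (simp add: blinfun.zero_right)
  then show ?thesis by (intro blinfun_eqI) simp
qed

text \<open>
  A sequence of polynomials converging on the spectrum need not converge at \<open>0\<close> if \<open>0\<close> is not in
  the spectrum, but then the coefficient \<open>id_blinfun - P\<close> of its value there is zero; likewise
  for \<open>1\<close> and \<open>P\<close>.  Uniqueness of the limit needs one convergent sequence: the linear
  interpolation of \<open>f\<close> at \<open>0\<close> and \<open>1\<close>.
\<close>

lemma fun_calculus_idempotent: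
  fixes P :: "'a::complex_hilbert \<Rightarrow>\<^sub>L 'a"
  assumes P: "P o\<^sub>L P = P"
  shows "fun_calculus f P = f 0 *\<^sub>R (id_blinfun - P) + f 1 *\<^sub>R P"
proof -
  define \<sigma> where "\<sigma> = {t. complex_of_real t \<in> op_spectrum P}"
  define L where "L = f 0 *\<^sub>R (id_blinfun - P) + f 1 *\<^sub>R P"
  have lim: "(\<lambda>n. op_poly (q n) P) \<longlonglongrightarrow> L"
    if "uniform_limit \<sigma> (\<lambda>n. poly (q n)) f sequentially" for q
  proof -
    have "(\<lambda>n. poly (q n) 0 *\<^sub>R (id_blinfun - P)) \<longlonglongrightarrow> f 0 *\<^sub>R (id_blinfun - P)"
    proof (cases "0 \<in> op_spectrum P")
      case True
      then have "(\<lambda>n. poly (q n) 0) \<longlonglongrightarrow> f 0"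
        using that by (intro tendsto_uniform_limitI) (auto simp: \<sigma>_def)
      then show ?thesis by (intro tendsto_intros)
    next
      case False
      then show ?thesis using zero_in_op_spectrum_idempotent[OF P] by simp
    qed
    moreover have "(\<lambda>n. poly (q n) 1 *\<^sub>R P) \<longlonglongrightarrow> f 1 *\<^sub>R P"
    proof (cases "1 \<in> op_spectrum P")
      case True
      then have "(\<lambda>n. poly (q n) 1) \<longlonglongrightarrow> f 1"
        using that by (intro tendsto_uniform_limitI) (auto simp: \<sigma>_def)
      then show ?thesis by (intro tendsto_intros)
    next
      case False
      then show ?thesis using one_in_op_spectrum_idempotent[OF P] by simp
    qed
    ultimately show ?thesis
      unfolding op_poly_idempotent[OF P] L_def by (rule tendsto_add)
  qed
  have "poly [:f 0, f 1 - f 0:] t = f t" if "t \<in> \<sigma>" for t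
    using that op_spectrum_idempotent_subset[OF P, of t] by (auto simp: \<sigma>_def)
  then have interp: "uniform_limit \<sigma> (\<lambda>n::nat. poly [:f 0, f 1 - f 0:]) f sequentially"
    by (intro uniform_limitI always_eventually) simp
  have "fun_calculus f P = L"
    unfolding fun_calculus_def \<sigma>_def[symmetric]
  proof (rule the_equality)
    fix B
    assume "\<forall>q. uniform_limit \<sigma> (\<lambda>n. poly (q n)) f sequentially
      \<longrightarrow> (\<lambda>n. op_poly (q n) P) \<longlonglongrightarrow> B"
    from this[rule_format, OF interp] lim[OF interp] show "B = L"
      by (rule LIMSEQ_unique)
  qed (use lim in blast)
  then show ?thesis by (simp add: L_def)
qed

lemma op_powr_idempotent:
  fixes P :: "'a::complex_hilbert \<Rightarrow>\<^sub>L 'a"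
  assumes "P o\<^sub>L P = P"
  shows "op_powr P p = P"
  by (simp add: op_powr_def fun_calculus_idempotent[OF assms])

section \<open>Orthogonal projections and partial isometries\<close>

lemma projection_norm_sq:
  fixes P :: "'a::complex_inner \<Rightarrow>\<^sub>L 'a"
  assumes idem: "\<And>x. P (P x) = P x" and sa: "\<And>x y. cinner (P x) y = cinner x (P y)"
  shows "(norm x)\<^sup>2 = (norm (P x))\<^sup>2 + (norm (x - P x))\<^sup>2"
proof -
  have "Re (cinner (P x) (x - P x)) = 0"
    by (simp add: sa blinfun.diff_right idem bounded_bilinear.zero_right[OF bounded_bilinear_Re_cinner])
  then show ?thesis
    using norm_add_sq[of "P x" "x - P x"] by simp
qed

lemma projection_norm_le:
  fixes P :: "'a::complex_inner \<Rightarrow>\<^sub>L 'a"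
  assumes idem: "\<And>x. P (P x) = P x" and sa: "\<And>x y. cinner (P x) y = cinner x (P y)"
  shows "norm (P x) \<le> norm x"
  using projection_norm_sq[OF assms, of x] by (simp add: power2_le_imp_le)

text \<open>This is the equality case of \<open>\<parallel>x\<parallel>\<^sup>2 = \<parallel>P x\<parallel>\<^sup>2 + \<parallel>x - P x\<parallel>\<^sup>2\<close>.\<close>

lemma projection_fixes_if_norm_ge:
  fixes P :: "'a::complex_inner \<Rightarrow>\<^sub>L 'a"
  assumes idem: "\<And>x. P (P x) = P x" and sa: "\<And>x y. cinner (P x) y = cinner x (P y)"
    and "norm x \<le> norm (P x)"
  shows "P x = x"
proof -
  have "(norm x)\<^sup>2 \<le> (norm (P x))\<^sup>2" using assms(3) by (intro power_mono) auto
  then have "(norm (x - P x))\<^sup>2 \<le> 0" using projection_norm_sq[OF idem sa, of x] by simp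
  then show ?thesis by simp
qed

theorem theorem5p1:
  fixes V :: "'a::complex_hilbert \<Rightarrow>\<^sub>L 'a"
  assumes "complex_linear V"
    and "partial_isometry V"
  shows "(quasinormal V \<longleftrightarrow> (\<exists>p r. p > 0 \<and> r > 0 \<and> absolute_paranormal p r V))
    \<and> (quasinormal V \<longleftrightarrow>
          op_power (cadjoint V) 2 o\<^sub>L op_power V 2 = cadjoint V o\<^sub>L V)
    \<and> (quasinormal V \<longleftrightarrow>
          op_ge (op_power (cadjoint V) 2 o\<^sub>L op_power V 2) (cadjoint V o\<^sub>L V))"
proof -
  define W where "W = cadjoint V"
  define P where "P = W o\<^sub>L V"
  define Q where "Q = V o\<^sub>L W"
  have P_apply: "P x = W (V x)" and Q_apply: "Q x = V (W x)" for x
    by (simp_all add: P_def Q_def)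
  have VW: "cinner (V x) y = cinner x (W y)" for x y
    unfolding W_def by (rule cinner_cadjoint[OF assms(1)])
  have WV: "cinner (W x) y = cinner x (V y)" for x y
    by (metis VW cinner_commute)
  have P_idem: "P o\<^sub>L P = P"
    using assms(2) by (simp add: partial_isometry_def orthogonal_projection_def P_def W_def)
  have PP: "P (P x) = P x" for x
    using P_idem by (metis blinfun_apply_blinfun_compose)
  have P_sa: "cinner (P x) y = cinner x (P y)" for x y
    by (simp add: P_apply VW WV)
  have VP: "V (P x) = V x" for x
  proof -
    have "(norm (V (x - P x)))\<^sup>2 = Re (cinner (x - P x) (P (x - P x)))"
      by (simp add: norm_sq_eq_Re_cinner VW P_apply)
    also have "\<dots> = 0"
      by (simp add: blinfun.diff_right PP bounded_bilinear.zero_right[OF bounded_bilinear_Re_cinner])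
    finally show ?thesis by (simp add: blinfun.diff_right)
  qed
  have QV: "Q (V x) = V x" for x
    using VP by (simp add: P_apply Q_apply)
  have QQ: "Q (Q x) = Q x" for x
    using QV by (simp add: Q_apply)
  have Q_idem: "Q o\<^sub>L Q = Q"
    by (rule blinfun_eqI) (simp add: QQ)
  have Q_sa: "cinner (Q x) y = cinner x (Q y)" for x y
    by (simp add: Q_apply VW WV)

  have quasi: "quasinormal V \<longleftrightarrow> (\<forall>x. P (V x) = V x)"
    unfolding quasinormal_def W_def[symmetric] P_def[symmetric]
    by (metis VP blinfun_apply_blinfun_compose blinfun_eqI)

  have WW: "cadjoint W = V"
    unfolding W_def by (rule cadjoint_cadjoint[OF assms(1)])
  have abs_V: "op_powr (op_abs V) p = P" for p
    by (simp add: op_abs_def W_def[symmetric] P_def[symmetric] op_powr_idempotent[OF P_idem])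
  have abs_W: "op_powr (op_abs (cadjoint V)) r = Q" for r
    by (simp add: op_abs_def W_def[symmetric] WW Q_def[symmetric] op_powr_idempotent[OF Q_idem])
  have para: "absolute_paranormal p r V \<longleftrightarrow>
      (\<forall>x. norm x = 1 \<longrightarrow> norm (Q x) powr (p + r) \<le> norm (P (Q x)) powr r)" for p r
    by (simp add: absolute_paranormal_def abs_V abs_W)

  have square_apply: "(op_power W 2 o\<^sub>L op_power V 2) x = W (P (V x))" for x
    by (simp add: numeral_2_eq_2 P_apply)
  have ge: "Re (cinner (((op_power W 2 o\<^sub>L op_power V 2) - P) x) x)
      = (norm (P (V x)))\<^sup>2 - (norm (V x))\<^sup>2" for x
  proof -
    have "Re (cinner (W (P (V x))) x) = (norm (P (V x)))\<^sup>2"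
      unfolding norm_sq_eq_Re_cinner WV by (metis P_sa PP)
    moreover have "Re (cinner (P x) x) = (norm (V x))\<^sup>2"
      by (simp add: norm_sq_eq_Re_cinner P_apply WV)
    ultimately show ?thesis
      unfolding blinfun.diff_left Re_cinner_diff_left square_apply by simp
  qed

  have i_ii: "absolute_paranormal 1 1 V" if PV: "\<forall>x. P (V x) = V x"
    unfolding para
  proof (intro allI impI)
    fix x :: 'a assume "norm x = 1"
    then have "norm (Q x) \<le> 1" using projection_norm_le[OF QQ Q_sa, of x] by simp
    then have "norm (Q x) powr (1 + 1) \<le> norm (Q x) powr 1"
      by (intro powr_mono') auto
    moreover have "P (Q x) = Q x" using PV by (simp add: Q_apply)
    ultimately show "norm (Q x) powr (1 + 1) \<le> norm (P (Q x)) powr 1" by simp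
  qed

  have ii_i: "P (V x) = V x" if "r > 0" and pr: "absolute_paranormal p r V" for p r x
  proof (cases "V x = 0")
    case True
    then show ?thesis by (simp add: blinfun.zero_right)
  next
    case False
    \<comment> \<open>At a unit vector fixed by \<open>Q\<close> the bound \<open>\<parallel>Q u\<parallel>\<^sup>p\<^sup>+\<^sup>r\<close> is \<open>1\<close> whatever \<open>p\<close> and \<open>r\<close> are.\<close>
    define u where "u = (1 / norm (V x)) *\<^sub>R V x"
    have u: "norm u = 1" "Q u = u"
      using False by (simp_all add: u_def blinfun.scaleR_right QV)
    then have "1 \<le> norm (P u) powr r" using pr unfolding para by (metis powr_one_eq_one)
    then have "norm u \<le> norm (P u)"
      using \<open>r > 0\<close> u(1) powr_less_one[of "norm (P u)" r]
      by (metis norm_ge_zero not_le powr_less_mono2 powr_one_eq_one)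
    then have "P u = u" by (rule projection_fixes_if_norm_ge[OF PP P_sa])
    then show ?thesis using False by (simp add: u_def blinfun.scaleR_right)
  qed

  have i_iii: "op_power W 2 o\<^sub>L op_power V 2 = P" if "\<forall>x. P (V x) = V x"
    by (rule blinfun_eqI, subst square_apply) (simp add: that, simp add: P_apply)

  have iii_iv: "op_ge (op_power W 2 o\<^sub>L op_power V 2) P" if "op_power W 2 o\<^sub>L op_power V 2 = P"
    by (simp add: that op_ge_def cinner_zero_left)

  have iv_i: "P (V x) = V x" if "op_ge (op_power W 2 o\<^sub>L op_power V 2) P" for x
  proof (rule projection_fixes_if_norm_ge[OF PP P_sa])
    have "0 \<le> Re (cinner (((op_power W 2 o\<^sub>L op_power V 2) - P) x) x)"
      using that unfolding op_ge_def by (metis complex_nonneg_Reals_iff)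
    then show "norm (V x) \<le> norm (P (V x))"
      unfolding ge by (simp add: power2_le_imp_le[OF _ norm_ge_zero])
  qed

  have "quasinormal V \<longleftrightarrow> (\<exists>p r. p > 0 \<and> r > 0 \<and> absolute_paranormal p r V)"
    using quasi i_ii ii_i zero_less_one by blast
  moreover have "quasinormal V \<longleftrightarrow> op_power W 2 o\<^sub>L op_power V 2 = P"
    using quasi i_iii iii_iv iv_i by blast
  moreover have "quasinormal V \<longleftrightarrow> op_ge (op_power W 2 o\<^sub>L op_power V 2) P"
    using quasi i_iii iii_iv iv_i by blast
  ultimately show ?thesis unfolding P_def W_def by blast
qed

end
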